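(* Let $\mathsf{H}$ be a (right) quaternionic Hilbert space and let $T:\mathsf{H}\to\mathsf{H}$ be a bounded right $\mathbb{H}$-linear operator. Assume that there exist a Hilbert basis $\mathcal{N}$ of $\mathsf{H}$ and a map $\mathcal{N}\ni z\mapsto\lambda_z\in\mathbb{H}$, with set of values $\Lambda:=\{\lambda_z : z\in\mathcal{N}\}$, satisfying the following requirements: (i) $Tx=\sum_{z\in\mathcal{N}}z\lambda_z\langle z|x\rangle$ for every $x\in\mathsf{H}$; (ii) for every $z\in\mathcal{N}$ such that $\lambda_z\neq0$, only a finite number of distinct other elements $z'\in\mathcal{N}$ satisfy $\lambda_z=\lambda_{z'}$; (iii) the set $\Lambda$ is at most countable; (iv) for every $\epsilon>0$ there is a finite set $\Lambda_\epsilon\subset\Lambda$ such that $|\lambda|<\epsilon$ for every $\lambda\in\Lambda\setminus\Lambda_\epsilon$. Then $T$ is normal and compact, and $$\sigma_S(T)\setminus\{0\}=\Omega_\Lambda\setminus\{0\},$$ where $\sigma_S(T)$ is the spherical spectrum of $T$ and $\Omega_\Lambda$ is the circularization of $\Lambda$ in $\mathbb{H}$.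
   Context: $\mathbb{H}$ denotes the skew field of quaternions, with conjugation $q\mapsto\overline{q}$ and norm $|q|=\sqrt{\overline{q}q}$, and $\mathbb{S}:=\{q\in\mathbb{H} : q^2=-1\}$ is the sphere of imaginary units. For $\Lambda\subset\mathbb{H}$, the circularization is $$\Omega_\Lambda:=\{\alpha+\jmath\beta\in\mathbb{H} : \alpha,\beta\in\mathbb{R},\ \jmath\in\mathbb{S},\ \alpha+\imath\beta\in\Lambda \text{ for some } \imath\in\mathbb{S}\},$$ i.e. the union of the conjugacy classes $\{\mu^{-1}\lambda\mu : \mu\in\mathbb{H}\setminus\{0\}\}$ of the elements $\lambda\in\Lambda$. A (right) quaternionic Hilbert space is a right $\mathbb{H}$-module $\mathsf{H}$ with a map $\mathsf{H}\times\mathsf{H}\ni(u,v)\mapsto\langle u|v\rangle\in\mathbb{H}$ such that $\langle u|vp+wq\rangle=\langle u|v\rangle p+\langle u|w\rangle q$, $\langle u|v\rangle=\overline{\langle v|u\rangle}$, $\langle u|u\rangle$ is a real number $\ge 0$, and $\langle u|u\rangle=0$ implies $u=0$ (for all $u,v,w\in\mathsf{H}$, $p,q\in\mathbb{H}$), and which is complete for the norm $\|u\|=\sqrt{\langle u|u\rangle}$. A Hilbert basis of $\mathsf{H}$ is an orthonormal subset $\mathcal{N}$ (possibly uncountable) such that $x=\sum_{z\in\mathcal{N}}z\langle z|x\rangle$ for every $x\in\mathsf{H}$; sums over $\mathcal{N}$ are unconditional sums converging in norm. A map $T:\mathsf{H}\to\mathsf{H}$ is right $\mathbb{H}$-linear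 if $T(ua+vb)=(Tu)a+(Tv)b$ for all $u,v\in\mathsf{H}$, $a,b\in\mathbb{H}$. It is bounded if there is $K\ge0$ with $\|Tu\|\le K\|u\|$ for all $u$. It is compact if it maps bounded sequences to sequences admitting convergent subsequences. The adjoint $T^*$ of a bounded $T$ is defined by $\langle T^*u|v\rangle=\langle u|Tv\rangle$ for all $u,v$; $T$ is normal if $TT^*=T^*T$. For $T$ bounded and $q\in\mathbb{H}$ put $\Delta_q(T):=T^2-T(q+\overline{q})+\mathrm{I}|q|^2$, where $\mathrm{I}$ is the identity and for $r\in\mathbb{R}$ the operator $Tr$ is $u\mapsto (Tu)r$. The spherical resolvent set $\rho_S(T)$ is the set of $q\in\mathbb{H}$ such that $\mathrm{Ker}(\Delta_q(T))=\{0\}$, $\mathrm{Range}(\Delta_q(T))$ is dense in $\mathsf{H}$, and $\Delta_q(T)^{-1}:\mathrm{Range}(\Delta_q(T))\to\mathsf{H}$ is bounded. The spherical spectrum is $\sigma_S(T):=\mathbb{H}\setminus\rho_S(T)$. *)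

theory Defs
  imports "HOL-Analysis.Analysis"
begin

section \<open>Quaternions\<close>

codatatype quat = Quat (qRe: real) (qI: real) (qJ: real) (qK: real)

lemma quat_eqI [intro?]:
  "qRe x = qRe y \<Longrightarrow> qI x = qI y \<Longrightarrow> qJ x = qJ y \<Longrightarrow> qK x = qK y \<Longrightarrow> x = y"
  by (rule quat.expand) simp

lemma quat_eq_iff: "x = y \<longleftrightarrow> qRe x = qRe y \<and> qI x = qI y \<and> qJ x = qJ y \<and> qK x = qK y"
  by (auto intro: quat.expand)

instantiation quat :: real_vector
begin

primcorec zero_quat where
  "qRe 0 = 0" | "qI 0 = 0" | "qJ 0 = 0" | "qK 0 = 0"

primcorec plus_quat where
  "qRe (x + y) = qRe x + qRe y"
| "qI (x + y) = qI x + qI y"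
| "qJ (x + y) = qJ x + qJ y"
| "qK (x + y) = qK x + qK y"

primcorec uminus_quat where
  "qRe (- x) = - qRe x" | "qI (- x) = - qI x" | "qJ (- x) = - qJ x" | "qK (- x) = - qK x"

primcorec minus_quat where
  "qRe (x - y) = qRe x - qRe y"
| "qI (x - y) = qI x - qI y"
| "qJ (x - y) = qJ x - qJ y"
| "qK (x - y) = qK x - qK y"

primcorec scaleR_quat where
  "qRe (scaleR r x) = r * qRe x"
| "qI (scaleR r x) = r * qI x"
| "qJ (scaleR r x) = r * qJ x"
| "qK (scaleR r x) = r * qK x"

instance
  by standard (simp_all add: quat_eq_iff algebra_simps)

end

instantiation quat :: real_algebra_1
begin

primcorec one_quat where
  "qRe 1 = 1" | "qI 1 = 0" | "qJ 1 = 0" | "qK 1 = 0"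

primcorec times_quat where
  "qRe (x * y) = qRe x * qRe y - qI x * qI y - qJ x * qJ y - qK x * qK y"
| "qI (x * y) = qRe x * qI y + qI x * qRe y + qJ x * qK y - qK x * qJ y"
| "qJ (x * y) = qRe x * qJ y - qI x * qK y + qJ x * qRe y + qK x * qI y"
| "qK (x * y) = qRe x * qK y + qI x * qJ y - qJ x * qI y + qK x * qRe y"

instance
  by standard (simp_all add: quat_eq_iff algebra_simps)

end

lemma quat_sel_of_real [simp]:
  "qRe (of_real r) = r" "qI (of_real r) = 0" "qJ (of_real r) = 0" "qK (of_real r) = 0"
  by (simp_all add: of_real_def)

primcorec qcnj :: "quat \<Rightarrow> quat" where
  "qRe (qcnj x) = qRe x" | "qI (qcnj x) = - qI x" | "qJ (qcnj x) = - qJ x" | "qK (qcnj x) = - qK x"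

lemma quat_sum_squares_eq_0:
  "(qRe x)\<^sup>2 + (qI x)\<^sup>2 + (qJ x)\<^sup>2 + (qK x)\<^sup>2 = 0 \<longleftrightarrow> x = 0"
  by (simp add: quat_eq_iff add_nonneg_eq_0_iff)

instantiation quat :: real_div_algebra
begin

definition inverse_quat :: "quat \<Rightarrow> quat" where
  "inverse x = qcnj x /\<^sub>R ((qRe x)\<^sup>2 + (qI x)\<^sup>2 + (qJ x)\<^sup>2 + (qK x)\<^sup>2)"

definition "x div y = x * inverse y" for x y :: quat

instance
proof
  fix x :: quat
  assume "x \<noteq> 0"
  then have "(qRe x)\<^sup>2 + (qI x)\<^sup>2 + (qJ x)\<^sup>2 + (qK x)\<^sup>2 \<noteq> 0"
    by (simp add: quat_sum_squares_eq_0)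
  moreover have "qcnj x * x = ((qRe x)\<^sup>2 + (qI x)\<^sup>2 + (qJ x)\<^sup>2 + (qK x)\<^sup>2) *\<^sub>R 1"
    and "x * qcnj x = ((qRe x)\<^sup>2 + (qI x)\<^sup>2 + (qJ x)\<^sup>2 + (qK x)\<^sup>2) *\<^sub>R 1"
    by (simp_all add: quat_eq_iff power2_eq_square algebra_simps)
  ultimately show "inverse x * x = 1" "x * inverse x = 1"
    unfolding inverse_quat_def by simp_all
next
  show "x div y = x * inverse y" for x y :: quat
    by (rule divide_quat_def)
  show "inverse (0::quat) = 0"
    by (simp add: inverse_quat_def quat_eq_iff)
qed

end

instantiation quat :: real_inner
begin

definition inner_quat :: "quat \<Rightarrow> quat \<Rightarrow> real" where
  "x \<bullet> y = qRe x * qRe y + qI x * qI y + qJ x * qJ y + qK x * qK y"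

definition norm_quat :: "quat \<Rightarrow> real" where
  "norm x = sqrt ((qRe x)\<^sup>2 + (qI x)\<^sup>2 + (qJ x)\<^sup>2 + (qK x)\<^sup>2)"

definition sgn_quat_def: "sgn x = x /\<^sub>R norm x" for x :: quat

definition dist_quat_def: "dist x y = norm (x - y)" for x y :: quat

definition uniformity_quat_def:
  "(uniformity :: (quat \<times> quat) filter) = (INF e\<in>{0 <..}. principal {(x, y). dist x y < e})"

definition open_quat_def:
  "open (U :: quat set) \<longleftrightarrow> (\<forall>x\<in>U. eventually (\<lambda>(x', y). x' = x \<longrightarrow> y \<in> U) uniformity)"

instance
proof
  fix x y z :: quat and r :: real
  show "x \<bullet> x = 0 \<longleftrightarrow> x = 0"
    using quat_sum_squares_eq_0[of x] by (simp add: inner_quat_def power2_eq_square)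
  show "norm x = sqrt (x \<bullet> x)"
    by (simp add: norm_quat_def inner_quat_def power2_eq_square)
qed (simp_all add: inner_quat_def algebra_simps sgn_quat_def dist_quat_def
      uniformity_quat_def open_quat_def)

end

instance quat :: real_normed_div_algebra
proof
  show "norm (x * y) = norm x * norm y" for x y :: quat
    by (simp add: norm_quat_def real_sqrt_mult [symmetric] power2_eq_square algebra_simps)
qed

lemma quat_norm_square: "of_real ((norm q)\<^sup>2) = qcnj q * q"
  by (simp add: norm_quat_def quat_eq_iff power2_eq_square algebra_simps)

definition imag_units :: "quat set" where
  "imag_units = {q. q\<^sup>2 = - 1}"

definition circularization :: "quat set \<Rightarrow> quat set" where
  "circularization \<Lambda> =
     {of_real \<alpha> + j * of_real \<beta> | \<alpha> \<beta> j.
        j \<in> imag_units \<and> (\<exists>i\<in>imag_units. of_real \<alpha> + i * of_real \<beta> \<in> \<Lambda>)}"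


section \<open>Right quaternionic Hilbert spaces\<close>

class right_quat_module = ab_group_add +
  fixes qscale :: "'a \<Rightarrow> quat \<Rightarrow> 'a"  (infixl "*\<^sub>H" 75)
  assumes qscale_add_left: "(u + v) *\<^sub>H p = u *\<^sub>H p + v *\<^sub>H p"
    and qscale_add_right: "u *\<^sub>H (p + q) = u *\<^sub>H p + u *\<^sub>H q"
    and qscale_qscale: "(u *\<^sub>H p) *\<^sub>H q = u *\<^sub>H (p * q)"
    and qscale_one [simp]: "u *\<^sub>H 1 = u"

class right_quat_inner = right_quat_module +
  fixes qinner :: "'a \<Rightarrow> 'a \<Rightarrow> quat"
  assumes qinner_linear_right:
      "qinner u (v *\<^sub>H p + w *\<^sub>H q) = qinner u v * p + qinner u w * q"
    and qinner_commute: "qinner u v = qcnj (qinner v u)"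
    and qinner_self_real: "qinner u u \<in> \<real>"
    and qinner_self_nonneg: "0 \<le> qRe (qinner u u)"
    and qinner_self_eq_0: "qinner u u = 0 \<Longrightarrow> u = 0"

text \<open>
  The norm, the metric and the real scaling of a quaternionic Hilbert space are determined by its
  inner product and its right scaling; the class \<^class>\<open>banach\<close> serves to connect
  them with the library's topology and to express completeness.  Its norm and vector space axioms
  hold automatically: the triangle inequality is lemma \<open>qinner_triangle\<close> below.
\<close>

class quat_hilbert = right_quat_inner + banach +
  assumes scaleR_eq_qscale: "scaleR r u = u *\<^sub>H of_real r"
    and norm_eq_sqrt_qinner: "norm u = sqrt (qRe (qinner u u))"

lemma qinner_triangle:
  fixes u v :: "'a::right_quat_inner"
  shows "sqrt (qRe (qinner (u + v) (u + v))) \<le> sqrt (qRe (qinner u u)) + sqrt (qRe (qinner v v))"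
proof -
  define a b c where "a = qRe (qinner u u)" and "b = qRe (qinner u v)" and "c = qRe (qinner v v)"
  have lin: "qRe (qinner x (y *\<^sub>H of_real s + z *\<^sub>H of_real t)) = s * qRe (qinner x y) + t * qRe (qinner x z)"
    for x y z :: 'a and s t
    by (simp add: qinner_linear_right)
  have sym: "qRe (qinner x y) = qRe (qinner y x)" for x y :: 'a
    by (subst qinner_commute) simp
  have quad: "qRe (qinner w w) = s\<^sup>2 * a + 2 * s * t * b + t\<^sup>2 * c"
    if "w = u *\<^sub>H of_real s + v *\<^sub>H of_real t" for w s t
  proof -
    have "qRe (qinner w w) = s * qRe (qinner u w) + t * qRe (qinner v w)"
      by (metis that lin sym)
    also have "qRe (qinner u w) = s * a + t * b"
      by (simp add: that lin a_def b_def)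
    also have "qRe (qinner v w) = s * b + t * c"
      by (simp add: that lin c_def b_def sym[of v u])
    finally show ?thesis
      by (simp add: power2_eq_square algebra_simps)
  qed
  have nonneg: "0 \<le> s\<^sup>2 * a + 2 * s * t * b + t\<^sup>2 * c" for s t
    using quad[OF refl, of s t] qinner_self_nonneg by metis
  have a: "0 \<le> a" and c: "0 \<le> c"
    by (simp_all add: a_def c_def qinner_self_nonneg)
  have eq: "qRe (qinner (u + v) (u + v)) = a + 2 * b + c"
    using quad[of "u + v" 1 1] by simp
  have "b \<le> sqrt a * sqrt c"
  proof (cases "c = 0")
    case True
    have "b \<le> 0"
    proof (rule ccontr)
      assume "\<not> b \<le> 0"
      then show False
        using nonneg[of 1 "- (a + 1) / (2 * b)"] True by (simp add: field_simps)
    qed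
    with True show ?thesis by simp
  next
    case False
    with c have "0 < c" by simp
    have "c\<^sup>2 * a - 2 * c * b * b + b\<^sup>2 * c = c * (c * a - b\<^sup>2)"
      by (simp add: power2_eq_square algebra_simps)
    with nonneg[of c "- b"] have "0 \<le> c * (c * a - b\<^sup>2)"
      by (simp add: algebra_simps)
    with \<open>0 < c\<close> have "b\<^sup>2 \<le> a * c"
      by (simp add: zero_le_mult_iff mult.commute)
    then show ?thesis
      by (metis real_le_rsqrt real_sqrt_mult)
  qed
  then have "a + 2 * b + c \<le> (sqrt a + sqrt c)\<^sup>2"
    using a c by (simp add: power2_sum)
  then have "sqrt (a + 2 * b + c) \<le> sqrt a + sqrt c"
    using a c by (intro real_le_lsqrt) auto
  then show ?thesis
    unfolding eq by (simp add: a_def c_def)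
qed

instantiation quat :: quat_hilbert
begin

definition qscale_quat :: "quat \<Rightarrow> quat \<Rightarrow> quat" where
  "u *\<^sub>H p = u * p"

definition qinner_quat :: "quat \<Rightarrow> quat \<Rightarrow> quat" where
  "qinner u v = qcnj u * v"

instance
proof
  fix u v w p q :: quat and r :: real
  show "qinner u u \<in> \<real>"
    unfolding qinner_quat_def quat_norm_square [symmetric] by (rule Reals_of_real)
  show "0 \<le> qRe (qinner u u)"
    unfolding qinner_quat_def quat_norm_square [symmetric] by (simp del: of_real_power)
  show "qinner u u = 0 \<Longrightarrow> u = 0"
    unfolding qinner_quat_def quat_norm_square [symmetric] by (simp del: of_real_power)
  show "norm u = sqrt (qRe (qinner u u))"
    unfolding qinner_quat_def quat_norm_square [symmetric] by (simp del: of_real_power)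
next
  fix X :: "nat \<Rightarrow> quat"
  assume X: "Cauchy X"
  have comp: "convergent (\<lambda>n. f (X n))" if "linear f" "\<And>q. \<bar>f q\<bar> \<le> norm q" for f :: "quat \<Rightarrow> real"
  proof -
    have "bounded_linear f"
      using that by (auto intro!: bounded_linear.intro bounded_linear_axioms.intro exI[of _ 1])
    then show ?thesis
      using X by (simp add: bounded_linear.Cauchy Cauchy_convergent)
  qed
  have lin: "linear qRe" "linear qI" "linear qJ" "linear qK"
    by (auto intro!: linearI)
  have bnd: "\<bar>qRe q\<bar> \<le> norm q" "\<bar>qI q\<bar> \<le> norm q" "\<bar>qJ q\<bar> \<le> norm q" "\<bar>qK q\<bar> \<le> norm q" for q
    by (auto simp: norm_quat_def intro!: real_le_rsqrt)
  obtain a b c d where lim: "(\<lambda>n. qRe (X n)) \<longlonglongrightarrow> a" "(\<lambda>n. qI (X n)) \<longlonglongrightarrow> b"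
      "(\<lambda>n. qJ (X n)) \<longlonglongrightarrow> c" "(\<lambda>n. qK (X n)) \<longlonglongrightarrow> d"
    using comp[OF lin(1) bnd(1)] comp[OF lin(2) bnd(2)] comp[OF lin(3) bnd(3)] comp[OF lin(4) bnd(4)]
    unfolding convergent_def by blast
  have "(\<lambda>n. norm (X n - Quat a b c d)) \<longlonglongrightarrow> sqrt ((a - a)\<^sup>2 + (b - b)\<^sup>2 + (c - c)\<^sup>2 + (d - d)\<^sup>2)"
    unfolding norm_quat_def minus_quat.sel quat.sel by (intro tendsto_intros lim)
  then have "X \<longlonglongrightarrow> Quat a b c d"
    by (simp add: tendsto_norm_zero_iff LIM_zero_cancel)
  then show "convergent X"
    by (rule convergentI)
qed (simp_all add: qscale_quat_def qinner_quat_def quat_eq_iff algebra_simps)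

end

definition hilbert_basis :: "'h::quat_hilbert set \<Rightarrow> bool" where
  "hilbert_basis N \<longleftrightarrow>
     (\<forall>z\<in>N. \<forall>z'\<in>N. qinner z z' = (if z = z' then 1 else 0)) \<and>
     (\<forall>x. ((\<lambda>z. z *\<^sub>H qinner z x) has_sum x) N)"


section \<open>Operators and the spherical spectrum\<close>

definition right_linear :: "('h::quat_hilbert \<Rightarrow> 'h) \<Rightarrow> bool" where
  "right_linear T \<longleftrightarrow> (\<forall>u v a b. T (u *\<^sub>H a + v *\<^sub>H b) = T u *\<^sub>H a + T v *\<^sub>H b)"

definition bounded_operator :: "('h::quat_hilbert \<Rightarrow> 'h) \<Rightarrow> bool" where
  "bounded_operator T \<longleftrightarrow> (\<exists>K\<ge>0. \<forall>u. norm (T u) \<le> K * norm u)"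

definition compact_operator :: "('h::quat_hilbert \<Rightarrow> 'h) \<Rightarrow> bool" where
  "compact_operator T \<longleftrightarrow>
     (\<forall>X :: nat \<Rightarrow> 'h. bounded (range X) \<longrightarrow>
        (\<exists>r :: nat \<Rightarrow> nat. strict_mono r \<and> convergent (\<lambda>n. T (X (r n)))))"

text \<open>For bounded right linear \<open>T\<close> the adjoint exists and is unique.\<close>

definition qadjoint :: "('h::quat_hilbert \<Rightarrow> 'h) \<Rightarrow> 'h \<Rightarrow> 'h" where
  "qadjoint T = (THE S. \<forall>u v. qinner (S u) v = qinner u (T v))"

definition normal_operator :: "('h::quat_hilbert \<Rightarrow> 'h) \<Rightarrow> bool" where
  "normal_operator T \<longleftrightarrow> T \<circ> qadjoint T = qadjoint T \<circ> T"

definition Delta_op :: "quat \<Rightarrow> ('h::quat_hilbert \<Rightarrow> 'h) \<Rightarrow> 'h \<Rightarrow> 'h" where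
  "Delta_op q T = (\<lambda>u. T (T u) - T u *\<^sub>H (q + qcnj q) + u *\<^sub>H of_real ((norm q)\<^sup>2))"

definition spherical_resolvent :: "('h::quat_hilbert \<Rightarrow> 'h) \<Rightarrow> quat set" where
  "spherical_resolvent T =
     {q. {u. Delta_op q T u = 0} = {0} \<and>
         closure (range (Delta_op q T)) = UNIV \<and>
         (\<exists>K\<ge>0. \<forall>y\<in>range (Delta_op q T). norm (inv (Delta_op q T) y) \<le> K * norm y)}"

definition spherical_spectrum :: "('h::quat_hilbert \<Rightarrow> 'h) \<Rightarrow> quat set" where
  "spherical_spectrum T = - spherical_resolvent T"

end

theory Submission
  imports Defs
begin

text \<open>
  In the Hilbert basis, \<open>T\<close> is the diagonal operator with entries \<open>\<lambda>\<^sub>z\<close>. By Parseval's identity a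
  bounded family of entries defines a bounded diagonal operator, and diagonal operators compose
  entrywise. Hence \<open>T\<^sup>*\<close> is diagonal with conjugate entries, which commute with those of \<open>T\<close>, and
  \<open>\<Delta>\<^sub>q(T)\<close> is diagonal with entries \<open>\<lambda>\<^sub>z\<^sup>2 - 2\<lambda>\<^sub>z Re q + |q|\<^sup>2\<close>.
  Such an entry vanishes exactly when \<open>\<lambda>\<^sub>z\<close> is conjugate to \<open>q\<close>. As only finitely many entries of
  \<open>T\<close> have norm above a given positive bound, \<open>T\<close> is a norm limit of finite rank operators, and for
  \<open>q \<noteq> 0\<close> outside the circularization the entries of \<open>\<Delta>\<^sub>q(T)\<close> are bounded away from zero.
\<close>

section \<open>Quaternions\<close>

lemma qcnj_qcnj [simp]: "qcnj (qcnj x) = x"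
  by (simp add: quat_eq_iff)

lemma qcnj_add: "qcnj (x + y) = qcnj x + qcnj y"
  by (simp add: quat_eq_iff)

lemma qcnj_mult: "qcnj (x * y) = qcnj y * qcnj x"
  by (simp add: quat_eq_iff algebra_simps)

lemma norm_qcnj [simp]: "norm (qcnj x) = norm x"
  by (simp add: norm_quat_def)

lemma qcnj_mult_commute: "qcnj x * x = x * qcnj x"
  by (simp add: quat_eq_iff algebra_simps)

lemma add_qcnj: "q + qcnj q = of_real (2 * qRe q)"
  unfolding quat_eq_iff quat_sel_of_real by simp

lemma abs_qRe_le_norm: "\<bar>qRe q\<bar> \<le> norm q"
  by (auto simp: norm_quat_def intro!: real_le_rsqrt)

lemma bounded_linear_qRe: "bounded_linear qRe"
  using abs_qRe_le_norm
  by (auto intro!: bounded_linear.intro bounded_linear_axioms.intro linearI exI[of _ 1])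

lemma norm_quat_eq_iff:
  "norm x = norm y \<longleftrightarrow>
     (qRe x)\<^sup>2 + (qI x)\<^sup>2 + (qJ x)\<^sup>2 + (qK x)\<^sup>2 = (qRe y)\<^sup>2 + (qI y)\<^sup>2 + (qJ y)\<^sup>2 + (qK y)\<^sup>2"
  by (simp add: norm_quat_def)

lemma norm_quat_square: "(norm q)\<^sup>2 = (qRe q)\<^sup>2 + (qI q)\<^sup>2 + (qJ q)\<^sup>2 + (qK q)\<^sup>2"
  by (simp add: norm_quat_def)

section \<open>Roots of the real quadratic polynomial of a conjugacy class\<close>

text \<open>The imaginary components of the polynomial are those of \<open>l\<close> times
  \<open>2 * (qRe l - qRe q)\<close>. Hence at a root either the real parts agree, and the real
  component then compares the norms, or \<open>l\<close> is real, and the real component is a sum of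
  squares that cannot vanish.\<close>

lemma quat_polynomial_eq_0_iff:
  "l * l - l * (q + qcnj q) + of_real ((norm q)\<^sup>2) = 0 \<longleftrightarrow> qRe l = qRe q \<and> norm l = norm q"
    (is "?p = 0 \<longleftrightarrow> ?R")
proof -
  define w where "w = (qI q)\<^sup>2 + (qJ q)\<^sup>2 + (qK q)\<^sup>2"
  have n: "(norm q)\<^sup>2 = (qRe q)\<^sup>2 + w" and w: "0 \<le> w"
    by (simp_all add: norm_quat_square w_def)
  define v where "v = (qI l)\<^sup>2 + (qJ l)\<^sup>2 + (qK l)\<^sup>2"
  have R: "?R \<longleftrightarrow> qRe l = qRe q \<and> v = w"
    by (auto simp: norm_quat_eq_iff v_def w_def)
  have re: "qRe ?p = (qRe l)\<^sup>2 - v - 2 * qRe l * qRe q + (qRe q)\<^sup>2 + w"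
    unfolding add_qcnj n plus_quat.sel minus_quat.sel times_quat.sel quat_sel_of_real v_def
    by (simp add: power2_eq_square)
  have im: "qI ?p = 2 * qI l * (qRe l - qRe q)" "qJ ?p = 2 * qJ l * (qRe l - qRe q)"
    "qK ?p = 2 * qK l * (qRe l - qRe q)"
    unfolding add_qcnj plus_quat.sel minus_quat.sel times_quat.sel quat_sel_of_real
    by (simp_all add: algebra_simps)
  show ?thesis
  proof
    assume p: "?p = 0"
    have re0: "(qRe l)\<^sup>2 - v - 2 * qRe l * qRe q + (qRe q)\<^sup>2 + w = 0"
      unfolding re [symmetric] p by simp
    show ?R
    proof (cases "qRe l = qRe q")
      case True
      with re0 show ?thesis
        unfolding R by (simp add: power2_eq_square)
    next
      case False
      moreover have "qI ?p = 0" "qJ ?p = 0" "qK ?p = 0"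
        unfolding p by simp_all
      ultimately have "v = 0"
        unfolding im v_def by simp
      \<comment> \<open>Now \<open>l\<close> is real, so the polynomial takes the value \<bar>l -
        q\<bar>^2.\<close>
      with re0 have "(qRe l - qRe q)\<^sup>2 + w = 0"
        by (simp add: power2_diff)
      with w False show ?thesis
        by (simp add: add_nonneg_eq_0_iff)
    qed
  next
    assume ?R
    then have "qRe l = qRe q" "v = w"
      using R by auto
    with re im have "qRe ?p = 0" "qI ?p = 0" "qJ ?p = 0" "qK ?p = 0"
      by (simp_all add: power2_eq_square)
    then show "?p = 0"
      unfolding quat_eq_iff[of ?p 0] zero_quat.sel by blast
  qed
qed

text \<open>For small \<open>l\<close> the constant term dominates: the other two terms contribute
  at most 1/64 + 1/4 of \<open>(norm q)\<^sup>2\<close>, which is less than one half.\<close>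

lemma norm_quat_polynomial_ge:
  assumes "norm l \<le> norm q / 8"
  shows "(norm q)\<^sup>2 / 2 \<le> norm (l * l - l * (q + qcnj q) + of_real ((norm q)\<^sup>2))"
proof -
  have "norm (l * l) \<le> (norm q / 8) * (norm q / 8)"
    unfolding norm_mult using assms by (intro mult_mono) auto
  moreover have "norm (l * (q + qcnj q)) \<le> (norm q / 8) * (norm q + norm q)"
    unfolding norm_mult using assms norm_triangle_ineq[of q "qcnj q"] by (intro mult_mono) auto
  moreover have "norm (of_real ((norm q)\<^sup>2) :: quat) = (norm q)\<^sup>2"
    unfolding norm_of_real by simp
  moreover have "norm (of_real ((norm q)\<^sup>2) :: quat) \<le>
      norm (l * l - l * (q + qcnj q) + of_real ((norm q)\<^sup>2)) + (norm (l * l) + norm (l * (q + qcnj q)))"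
    by norm
  moreover have "(norm q / 8) * (norm q / 8) + (norm q / 8) * (norm q + norm q) \<le> (norm q)\<^sup>2 / 2"
    by (simp add: power2_eq_square field_simps)
  ultimately show ?thesis
    by linarith
qed

section \<open>Imaginary units, polar form and circularization\<close>

text \<open>The imaginary part of j^2 is twice the real part of j times its imaginary part. A unit
  with nonzero real part would therefore be a real number with square -1.\<close>

lemma imag_units_iff:
  "j \<in> imag_units \<longleftrightarrow> qRe j = 0 \<and> (qI j)\<^sup>2 + (qJ j)\<^sup>2 + (qK j)\<^sup>2 = 1"
proof
  assume "j \<in> imag_units"
  then have eqs: "qRe j * qRe j - qI j * qI j - qJ j * qJ j - qK j * qK j = -1"
    "qRe j * qI j = 0" "qRe j * qJ j = 0" "qRe j * qK j = 0"
    by (auto simp: imag_units_def power2_eq_square quat_eq_iff algebra_simps)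
  have "qRe j = 0"
  proof (rule ccontr)
    assume "qRe j \<noteq> 0"
    with eqs have "qRe j * qRe j = -1" by simp
    then show False
      by (metis neg_0_le_iff_le not_one_le_zero zero_le_square)
  qed
  with eqs show "qRe j = 0 \<and> (qI j)\<^sup>2 + (qJ j)\<^sup>2 + (qK j)\<^sup>2 = 1"
    by (simp add: power2_eq_square)
qed (auto simp: imag_units_def power2_eq_square quat_eq_iff)

lemma quat_polar:
  obtains j where "j \<in> imag_units" "q = of_real (qRe q) + j * of_real (sqrt ((norm q)\<^sup>2 - (qRe q)\<^sup>2))"
proof -
  define \<beta> where "\<beta> = sqrt ((norm q)\<^sup>2 - (qRe q)\<^sup>2)"
  have \<beta>2: "\<beta>\<^sup>2 = (qI q)\<^sup>2 + (qJ q)\<^sup>2 + (qK q)\<^sup>2"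
    by (simp add: \<beta>_def norm_quat_square)
  show thesis
  proof (cases "\<beta> = 0")
    case True
    then have "q = of_real (qRe q)"
      using \<beta>2 by (simp add: quat_eq_iff add_nonneg_eq_0_iff)
    \<comment> \<open>For real \<open>q\<close> the direction is arbitrary, and the first standard
      unit is taken.\<close>
    moreover have "Quat 0 1 0 0 \<in> imag_units"
      by (simp add: imag_units_iff)
    ultimately show thesis
      using that True by (simp add: \<beta>_def)
  next
    case False
    let ?j = "Quat 0 (qI q / \<beta>) (qJ q / \<beta>) (qK q / \<beta>)"
    have "?j \<in> imag_units"
      using False by (simp add: imag_units_iff power_divide flip: add_divide_distrib \<beta>2)
    moreover have "q = of_real (qRe q) + ?j * of_real \<beta>"
      using False by (simp add: quat_eq_iff)
    ultimately show thesis
      using that by (simp add: \<beta>_def)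
  qed
qed

text \<open>Real part and norm are complete invariants of a conjugacy class: \<alpha> + j\<beta> has
  real part \<alpha> and squared norm \<alpha>^2 + \<beta>^2, and conversely these two numbers fix
  the coefficients of the polar form with \<beta> \<ge> 0.\<close>

lemma circularization_iff:
  "q \<in> circularization \<Lambda> \<longleftrightarrow> (\<exists>l\<in>\<Lambda>. qRe l = qRe q \<and> norm l = norm q)"
proof
  have *: "qRe (of_real \<alpha> + j * of_real \<beta>) = \<alpha> \<and> (norm (of_real \<alpha> + j * of_real \<beta>))\<^sup>2 = \<alpha>\<^sup>2 + \<beta>\<^sup>2"
    if "j \<in> imag_units" for j \<alpha> \<beta>
  proof -
    have j: "qRe j = 0" "(qI j)\<^sup>2 + (qJ j)\<^sup>2 + (qK j)\<^sup>2 = 1"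
      using that imag_units_iff by auto
    have "(norm (of_real \<alpha> + j * of_real \<beta>))\<^sup>2 = \<alpha>\<^sup>2 + ((qI j)\<^sup>2 + (qJ j)\<^sup>2 + (qK j)\<^sup>2) * \<beta>\<^sup>2"
      using j(1) by (simp add: norm_quat_square power_mult_distrib algebra_simps)
    with j show ?thesis
      by simp
  qed
  assume "q \<in> circularization \<Lambda>"
  then obtain \<alpha> \<beta> j i where "j \<in> imag_units" "i \<in> imag_units"
    "q = of_real \<alpha> + j * of_real \<beta>" "of_real \<alpha> + i * of_real \<beta> \<in> \<Lambda>"
    unfolding circularization_def by blast
  then show "\<exists>l\<in>\<Lambda>. qRe l = qRe q \<and> norm l = norm q"
    using *[of j \<alpha> \<beta>] *[of i \<alpha> \<beta>]
    by (metis norm_ge_zero power2_eq_imp_eq)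
next
  assume "\<exists>l\<in>\<Lambda>. qRe l = qRe q \<and> norm l = norm q"
  then obtain l where l: "l \<in> \<Lambda>" "qRe l = qRe q" "norm l = norm q"
    by blast
  define \<beta> where "\<beta> = sqrt ((norm q)\<^sup>2 - (qRe q)\<^sup>2)"
  obtain j where "j \<in> imag_units" "q = of_real (qRe q) + j * of_real \<beta>"
    unfolding \<beta>_def by (rule quat_polar)
  moreover obtain i where "i \<in> imag_units" "l = of_real (qRe q) + i * of_real \<beta>"
    using quat_polar[of l] l unfolding \<beta>_def by metis
  ultimately show "q \<in> circularization \<Lambda>"
    using l(1) unfolding circularization_def by blast
qed

text \<open>The ball is a closed subset of the image of a real four-dimensional box under the
  continuous coordinate map. This provides compact coefficient sets for finite rank
  operators.\<close>

lemma compact_cball_quat: "compact (cball (0::quat) r)"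
proof -
  let ?f = "\<lambda>(a, b, c, d). Quat a b c d"
  have lim: "((\<lambda>x. Quat (f x) (g x) (h x) (k x)) \<longlongrightarrow> Quat a b c d) F"
    if "(f \<longlongrightarrow> a) F" "(g \<longlongrightarrow> b) F" "(h \<longlongrightarrow> c) F" "(k \<longlongrightarrow> d) F"
    for f g h k :: "real \<times> real \<times> real \<times> real \<Rightarrow> real" and a b c d F
  proof -
    have "((\<lambda>x. norm (Quat (f x) (g x) (h x) (k x) - Quat a b c d)) \<longlongrightarrow>
        sqrt ((a - a)\<^sup>2 + (b - b)\<^sup>2 + (c - c)\<^sup>2 + (d - d)\<^sup>2)) F"
      unfolding norm_quat_def minus_quat.sel quat.sel by (intro tendsto_intros that)
    then show ?thesis
      by (simp add: tendsto_norm_zero_iff LIM_zero_cancel)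
  qed
  have "continuous_on UNIV ?f"
    unfolding continuous_on_def case_prod_unfold by (intro ballI lim tendsto_intros)
  then have "compact (?f ` ({-r..r} \<times> {-r..r} \<times> {-r..r} \<times> {-r..r}))"
    by (intro compact_continuous_image compact_Times compact_Icc) (auto intro: continuous_on_subset)
  moreover have "cball 0 r \<subseteq> ?f ` ({-r..r} \<times> {-r..r} \<times> {-r..r} \<times> {-r..r})"
  proof
    fix q :: quat
    assume "q \<in> cball 0 r"
    then have "norm q \<le> r"
      by simp
    moreover have "\<bar>qRe q\<bar> \<le> norm q" "\<bar>qI q\<bar> \<le> norm q" "\<bar>qJ q\<bar> \<le> norm q" "\<bar>qK q\<bar> \<le> norm q"
      by (auto simp: norm_quat_def intro!: real_le_rsqrt)
    ultimately show "q \<in> ?f ` ({-r..r} \<times> {-r..r} \<times> {-r..r} \<times> {-r..r})"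
      by (intro image_eqI[of _ _ "(qRe q, qI q, qJ q, qK q)"]) auto
  qed
  ultimately show ?thesis
    by (metis closed_Int_compact closed_cball inf.absorb_iff1)
qed

section \<open>The quaternionic inner product\<close>

lemma qscale_zero_right [simp]: "(u::'h::right_quat_module) *\<^sub>H 0 = 0"
  using qscale_add_right[of u 0 0] by simp

lemma qinner_add_right: "qinner u (v + w :: 'h::right_quat_inner) = qinner u v + qinner u w"
  using qinner_linear_right[of u v 1 w 1] by simp

lemma qinner_scale_right: "qinner u (v *\<^sub>H p :: 'h::right_quat_inner) = qinner u v * p"
  using qinner_linear_right[of u v p v 0] by simp

lemma qinner_zero_right [simp]: "qinner u (0 :: 'h::right_quat_inner) = 0"
  using qinner_add_right[of u 0 0] by simp

lemma qinner_minus_right: "qinner u (- v :: 'h::right_quat_inner) = - qinner u v"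
  using qinner_add_right[of u v "- v"] by (simp add: eq_neg_iff_add_eq_0 add.commute)

lemma qinner_diff_right: "qinner u (v - w :: 'h::right_quat_inner) = qinner u v - qinner u w"
  using qinner_add_right[of u v "- w"] by (simp add: qinner_minus_right)

lemma qinner_sum_right:
  "qinner u (sum f A :: 'h::right_quat_inner) = (\<Sum>x\<in>A. qinner u (f x))"
  by (induction A rule: infinite_finite_induct) (simp_all add: qinner_add_right)

lemma qinner_add_left: "qinner (v + w :: 'h::right_quat_inner) u = qinner v u + qinner w u"
  by (metis qcnj_add qinner_add_right qinner_commute)

lemma qinner_scale_left: "qinner (v *\<^sub>H p :: 'h::right_quat_inner) u = qcnj p * qinner v u"
  by (metis qcnj_mult qinner_commute qinner_scale_right)

lemma qinner_self: "qinner u u = of_real ((norm u)\<^sup>2)" for u :: "'h::quat_hilbert"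
  using qinner_self_real[of u] qinner_self_nonneg[of u]
  by (auto simp: norm_eq_sqrt_qinner Reals_def)

lemma norm_square_qinner: "(norm u)\<^sup>2 = qRe (qinner u u)" for u :: "'h::quat_hilbert"
  by (simp add: norm_eq_sqrt_qinner qinner_self_nonneg)

lemma norm_qscale: "norm (u *\<^sub>H p) = norm u * norm p" for u :: "'h::quat_hilbert"
proof -
  have "qinner (u *\<^sub>H p) (u *\<^sub>H p) = qcnj p * of_real ((norm u)\<^sup>2) * p"
    unfolding qinner_scale_left qinner_scale_right by (simp only: qinner_self mult.assoc)
  \<comment> \<open>The real factor is central, so it can be moved out from between
    \<open>qcnj p\<close> and \<open>p\<close>.\<close>
  also have "\<dots> = of_real ((norm u)\<^sup>2) * of_real ((norm p)\<^sup>2)"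
    unfolding quat_norm_square[of p] by (simp del: of_real_power add: quat_eq_iff algebra_simps)
  also have "\<dots> = of_real ((norm u * norm p)\<^sup>2)"
    by (simp add: power_mult_distrib)
  finally have "(norm (u *\<^sub>H p))\<^sup>2 = (norm u * norm p)\<^sup>2"
    unfolding qinner_self of_real_eq_iff .
  then show ?thesis
    by (simp add: power2_eq_iff_nonneg)
qed

text \<open>Squaring the triangle inequality and expanding both sides leaves this bound.\<close>

lemma qRe_qinner_le: "qRe (qinner u v) \<le> norm u * norm v" for u v :: "'h::quat_hilbert"
proof -
  have "(norm (u + v))\<^sup>2 = (norm u)\<^sup>2 + 2 * qRe (qinner u v) + (norm v)\<^sup>2"
    unfolding norm_square_qinner qinner_add_left qinner_add_right
    by (subst (2) qinner_commute) simp
  moreover have "(norm (u + v))\<^sup>2 \<le> (norm u + norm v)\<^sup>2"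
    by (intro power_mono norm_triangle_ineq) simp
  ultimately show ?thesis
    by (simp add: power2_sum)
qed

text \<open>Cauchy-Schwarz: scaling \<open>v\<close> by the conjugate of \<open>qinner u v\<close>
  makes the inner product real, so the bound on real parts applies and one factor cancels.\<close>

lemma norm_qinner_le: "norm (qinner u v) \<le> norm u * norm v" for u v :: "'h::quat_hilbert"
proof (cases "qinner u v = 0")
  case False
  let ?p = "qinner u v"
  have "qinner u (v *\<^sub>H qcnj ?p) = of_real ((norm ?p)\<^sup>2)"
    by (simp only: qinner_scale_right quat_norm_square qcnj_mult_commute)
  then have "(norm ?p)\<^sup>2 \<le> norm u * norm v * norm ?p"
    using qRe_qinner_le[of u "v *\<^sub>H qcnj ?p"] by (simp add: norm_qscale mult.assoc del: of_real_power)
  with False show ?thesis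
    by (simp add: power2_eq_square)
qed simp

lemma bounded_linear_qinner: "bounded_linear (qinner (u :: 'h::quat_hilbert))"
proof (rule bounded_linear_intro[where K = "norm u"])
  show "qinner u (scaleR r x) = scaleR r (qinner u x)" for r x
    by (simp add: scaleR_eq_qscale[of r x] qinner_scale_right quat_eq_iff)
qed (simp_all add: qinner_add_right norm_qinner_le mult.commute[of _ "norm u"])

lemma bounded_linear_qscale: "bounded_linear (\<lambda>p. (u :: 'h::quat_hilbert) *\<^sub>H p)"
proof (rule bounded_linear_intro[where K = "norm u"])
  show "u *\<^sub>H scaleR r p = scaleR r (u *\<^sub>H p)" for r p
  proof -
    have "scaleR r p = p * of_real r"
      by (simp add: quat_eq_iff)
    then show ?thesis
      by (simp add: scaleR_eq_qscale[of r "u *\<^sub>H p"] qscale_qscale)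
  qed
qed (simp_all add: qscale_add_right norm_qscale)

section \<open>Expansions in a Hilbert basis\<close>

text \<open>Cauchy criterion for unconditional sums: small tails make the net of finite partial sums
  Cauchy, and completeness gives its limit.\<close>

lemma summable_on_CauchyI:
  fixes f :: "'a \<Rightarrow> 'b::banach"
  assumes "\<And>e. 0 < e \<Longrightarrow>
    \<exists>F0. finite F0 \<and> F0 \<subseteq> A \<and> (\<forall>F. finite F \<longrightarrow> F \<subseteq> A - F0 \<longrightarrow> norm (sum f F) < e)"
  shows "f summable_on A"
proof -
  have "\<exists>P. eventually P (finite_subsets_at_top A) \<and>
      (\<forall>F F'. P F \<and> P F' \<longrightarrow> dist (sum f F) (sum f F') < e)" if e: "0 < e" for e
  proof -
    obtain F0 where F0: "finite F0" "F0 \<subseteq> A"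
      and small: "\<And>F. finite F \<Longrightarrow> F \<subseteq> A - F0 \<Longrightarrow> norm (sum f F) < e / 2"
      using assms[OF half_gt_zero[OF e]] by blast
    let ?P = "\<lambda>F. finite F \<and> F0 \<subseteq> F \<and> F \<subseteq> A"
    have "eventually ?P (finite_subsets_at_top A)"
      unfolding eventually_finite_subsets_at_top using F0 by (intro exI[of _ F0]) simp
    moreover have "\<forall>F F'. ?P F \<and> ?P F' \<longrightarrow> dist (sum f F) (sum f F') < e"
    proof (intro allI impI)
      fix F F'
      assume FF': "?P F \<and> ?P F'"
      \<comment> \<open>The common part over \<open>F0\<close> cancels, leaving two tails of norm
        below \<open>e / 2\<close>.\<close>
      have "sum f F - sum f F' = sum f (F - F0) - sum f (F' - F0)"
        using FF' by (simp add: sum_diff[of _ F0])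
      moreover have "norm (sum f (F - F0)) < e / 2" "norm (sum f (F' - F0)) < e / 2"
        by (rule small; use FF' in auto)+
      ultimately show "dist (sum f F) (sum f F') < e"
        using norm_triangle_ineq4[of "sum f (F - F0)" "sum f (F' - F0)"] by (simp add: dist_norm)
    qed
    ultimately show ?thesis
      by (intro exI[of _ ?P] conjI)
  qed
  then have "cauchy_filter (filtermap (sum f) (finite_subsets_at_top A))"
    by (simp add: cauchy_filter_metric_filtermap)
  moreover have "complete (UNIV :: 'b set)"
    by (rule complete_UNIV)
  ultimately obtain L where "(sum f \<longlongrightarrow> L) (finite_subsets_at_top A)"
    using complete_uniform[where S = UNIV] by (force simp: filterlim_def)
  then show ?thesis
    unfolding summable_on_def has_sum_def by (rule exI)
qed

lemma qinner_hilbert_basis: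
  "\<lbrakk>hilbert_basis N; z \<in> N; w \<in> N\<rbrakk> \<Longrightarrow> qinner z w = (if z = w then 1 else 0)"
  by (simp add: hilbert_basis_def)

lemma has_sum_hilbert_basis:
  "hilbert_basis N \<Longrightarrow> ((\<lambda>z. z *\<^sub>H qinner z x) has_sum x) N"
  by (simp add: hilbert_basis_def)

lemma norm_hilbert_basis: "\<lbrakk>hilbert_basis N; z \<in> N\<rbrakk> \<Longrightarrow> norm z = 1"
  by (simp add: norm_eq_sqrt_qinner qinner_hilbert_basis)

lemma qinner_finite_expansion:
  assumes "hilbert_basis N" "z \<in> N" "F \<subseteq> N" "finite F"
  shows "qinner z (\<Sum>w\<in>F. w *\<^sub>H a w) = (if z \<in> F then a z else 0)"
proof -
  have "qinner z (\<Sum>w\<in>F. w *\<^sub>H a w) = (\<Sum>w\<in>F. if z = w then a w else 0)"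
    unfolding qinner_sum_right qinner_scale_right using assms
    by (intro sum.cong) (auto simp: qinner_hilbert_basis)
  then show ?thesis
    using assms by simp
qed

text \<open>The inner product with \<open>z\<close> is continuous and may be applied termwise;
  orthonormality then keeps the single term at \<open>z\<close>.\<close>

lemma qinner_expansion:
  assumes "hilbert_basis N" "z \<in> N" "((\<lambda>w. w *\<^sub>H a w) has_sum x) N"
  shows "qinner z x = a z"
proof (rule has_sum_unique)
  show "((\<lambda>w. qinner z (w *\<^sub>H a w)) has_sum qinner z x) N"
    by (rule has_sum_bounded_linear[OF bounded_linear_qinner assms(3)])
  show "((\<lambda>w. qinner z (w *\<^sub>H a w)) has_sum a z) N"
    using assms by (intro has_sum_finite_neutralI[of "{z}"])
      (auto simp: qinner_scale_right qinner_hilbert_basis)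
qed

lemma hilbert_basis_eqI:
  assumes "hilbert_basis N" "\<And>z. z \<in> N \<Longrightarrow> qinner z x = qinner z y"
  shows "x = y"
proof (rule has_sum_unique)
  show "((\<lambda>z. z *\<^sub>H qinner z x) has_sum x) N"
    by (rule has_sum_hilbert_basis[OF assms(1)])
  show "((\<lambda>z. z *\<^sub>H qinner z x) has_sum y) N"
    using has_sum_hilbert_basis[OF assms(1), of y] assms(2) by (simp cong: has_sum_cong)
qed

text \<open>Polarized Parseval identity, from the expansion of \<open>y\<close> by continuity of
  \<open>qinner x\<close>.\<close>

lemma has_sum_qinner:
  assumes "hilbert_basis N"
  shows "((\<lambda>z. qcnj (qinner z x) * qinner z y) has_sum qinner x y) N"
  using has_sum_bounded_linear[OF bounded_linear_qinner has_sum_hilbert_basis[OF assms], of x y]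
  by (simp add: qinner_scale_right flip: qinner_commute[of x])

lemma has_sum_norm_square:
  assumes "hilbert_basis N"
  shows "((\<lambda>z. (norm (qinner z x))\<^sup>2) has_sum (norm x)\<^sup>2) N"
  using has_sum_bounded_linear[OF bounded_linear_qRe has_sum_qinner[OF assms, of x x]]
  unfolding norm_square_qinner quat_norm_square [symmetric] quat_sel_of_real .

lemma norm_finite_expansion:
  assumes "hilbert_basis N" "finite F" "F \<subseteq> N"
  shows "(norm (\<Sum>z\<in>F. z *\<^sub>H a z))\<^sup>2 = (\<Sum>z\<in>F. (norm (a z))\<^sup>2)"
proof (rule has_sum_unique[OF has_sum_norm_square[OF assms(1)]])
  show "((\<lambda>z. (norm (qinner z (\<Sum>w\<in>F. w *\<^sub>H a w)))\<^sup>2) has_sum (\<Sum>z\<in>F. (norm (a z))\<^sup>2)) N"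
    using assms by (intro has_sum_finite_neutralI[of F]) (auto simp: qinner_finite_expansion subset_iff)
qed

text \<open>Riesz-Fischer: by Pythagoras the squared norm of a finite block of the series is a block
  of the convergent series of squares, so the Cauchy criterion holds.\<close>

lemma summable_expansion:
  assumes N: "hilbert_basis N" and "(\<lambda>z. (norm (a z))\<^sup>2) summable_on N"
  shows "(\<lambda>z. z *\<^sub>H a z) summable_on N"
proof (rule summable_on_CauchyI)
  fix e :: real
  assume "0 < e"
  let ?g = "\<lambda>z. (norm (a z))\<^sup>2"
  from assms(2) obtain L where L: "(?g has_sum L) N"
    unfolding summable_on_def by blast
  then have "eventually (\<lambda>F. dist (sum ?g F) L < e\<^sup>2) (finite_subsets_at_top N)"
    using \<open>0 < e\<close> by (simp add: has_sum_def tendsto_iff)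
  then obtain F0 where F0: "finite F0" "F0 \<subseteq> N" "dist (sum ?g F0) L < e\<^sup>2"
    unfolding eventually_finite_subsets_at_top by blast
  have "norm (\<Sum>z\<in>F. z *\<^sub>H a z) < e" if F: "finite F" "F \<subseteq> N - F0" for F
  proof -
    have "sum ?g (F0 \<union> F) = sum ?g F0 + sum ?g F"
      using F F0 by (intro sum.union_disjoint) auto
    \<comment> \<open>The terms are nonnegative, so a block disjoint from \<open>F0\<close> adds at
      most \<open>L - sum ?g F0\<close>.\<close>
    moreover have "sum ?g (F0 \<union> F) \<le> L"
      using F F0 by (intro finite_sum_le_has_sum[OF L]) auto
    ultimately have "sum ?g F < e\<^sup>2"
      using F0(3) by (simp add: dist_real_def)
    moreover have "F \<subseteq> N"
      using F by blast
    ultimately have "(norm (\<Sum>z\<in>F. z *\<^sub>H a z))\<^sup>2 < e\<^sup>2"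
      using norm_finite_expansion[OF N F(1)] by simp
    then show ?thesis
      using \<open>0 < e\<close> by (rule power2_less_imp_less[OF _ less_imp_le])
  qed
  with F0(1,2) show "\<exists>F0. finite F0 \<and> F0 \<subseteq> N \<and>
      (\<forall>F. finite F \<longrightarrow> F \<subseteq> N - F0 \<longrightarrow> norm (\<Sum>z\<in>F. z *\<^sub>H a z) < e)"
    by (intro exI[of _ F0]) simp
qed

section \<open>Diagonal operators\<close>

text \<open>The infinite sum has a default value where it diverges; over a Hilbert basis, entries
  bounded on \<open>N\<close> make it converge for every \<open>x\<close>.\<close>

definition diagonal_operator :: "'h::quat_hilbert set \<Rightarrow> ('h \<Rightarrow> quat) \<Rightarrow> 'h \<Rightarrow> 'h" where
  "diagonal_operator N c x = (\<Sum>\<^sub>\<infinity>z\<in>N. z *\<^sub>H (c z * qinner z x))"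

text \<open>Parseval, with the factor \<open>C\<^sup>2\<close>, dominates the squared coefficients,
  so the defining series converges and its coefficients can be read off.\<close>

lemma qinner_diagonal_operator:
  assumes N: "hilbert_basis N" and c: "\<And>z. z \<in> N \<Longrightarrow> norm (c z) \<le> C" and z: "z \<in> N"
  shows "qinner z (diagonal_operator N c x) = c z * qinner z x"
proof (rule qinner_expansion[OF N z])
  have "(\<lambda>z. (norm (qinner z x))\<^sup>2) summable_on N"
    using has_sum_norm_square[OF N] by (rule has_sum_imp_summable)
  then have "(\<lambda>z. C\<^sup>2 * (norm (qinner z x))\<^sup>2) summable_on N"
    by (rule summable_on_cmult_right)
  then have "(\<lambda>z. (norm (c z * qinner z x))\<^sup>2) summable_on N"
  proof (rule summable_on_comparison_test)
    show "(norm (c w * qinner w x))\<^sup>2 \<le> C\<^sup>2 * (norm (qinner w x))\<^sup>2" if "w \<in> N" for w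
      unfolding norm_mult power_mult_distrib by (intro mult_right_mono power_mono c[OF that]) simp_all
  qed simp
  then show "((\<lambda>w. w *\<^sub>H (c w * qinner w x)) has_sum diagonal_operator N c x) N"
    unfolding diagonal_operator_def by (rule has_sum_infsum[OF summable_expansion[OF N]])
qed

lemma norm_le_of_coefficients_le:
  assumes N: "hilbert_basis N" and "0 \<le> C"
    and le: "\<And>z. z \<in> N \<Longrightarrow> norm (qinner z y) \<le> C * norm (qinner z x)"
  shows "norm y \<le> C * norm x"
proof -
  have "(norm y)\<^sup>2 \<le> (C * norm x)\<^sup>2"
    unfolding power_mult_distrib
  proof (rule has_sum_mono[OF has_sum_norm_square[OF N]])
    show "((\<lambda>z. C\<^sup>2 * (norm (qinner z x))\<^sup>2) has_sum C\<^sup>2 * (norm x)\<^sup>2) N"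
      by (rule has_sum_cmult_right[OF has_sum_norm_square[OF N]])
    show "(norm (qinner z y))\<^sup>2 \<le> C\<^sup>2 * (norm (qinner z x))\<^sup>2" if "z \<in> N" for z
      using power_mono[OF le[OF that], of 2] by (simp add: power_mult_distrib)
  qed
  then show ?thesis
    by (rule power2_le_imp_le) (simp add: \<open>0 \<le> C\<close>)
qed

section \<open>Adjoint and normality\<close>

text \<open>Two candidates for the adjoint have the same inner products with every vector, in
  particular with their own difference, which is therefore zero.\<close>

lemma qadjoint_eqI:
  assumes "\<And>u v. qinner (S u) v = qinner u (T v)"
  shows "qadjoint T = S"
  unfolding qadjoint_def
proof (rule the_equality)
  fix S'
  assume S': "\<forall>u v. qinner (S' u) v = qinner u (T v)"
  have "qinner (S' u - S u) (S' u - S u) = 0" for u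
  proof -
    have "qinner (S' u) v = qinner (S u) v" for v
      using S' assms by simp
    then have "qinner v (S' u) = qinner v (S u)" for v
      by (metis qinner_commute)
    then show ?thesis
      by (simp add: qinner_diff_right)
  qed
  then show "S' = S"
    by (metis eq_iff_diff_eq_0 ext qinner_self_eq_0)
qed (use assms in blast)

text \<open>The adjoint is diagonal with conjugate entries, by comparing Parseval sums term by term,
  and a quaternion commutes with its conjugate.\<close>

lemma normal_operator_diagonal:
  assumes N: "hilbert_basis N" and C: "\<And>z. z \<in> N \<Longrightarrow> norm (c z) \<le> C"
    and T: "\<And>z x. z \<in> N \<Longrightarrow> qinner z (T x) = c z * qinner z x"
  shows "normal_operator T"
proof -
  define S where "S = diagonal_operator N (\<lambda>z. qcnj (c z))"
  have S: "qinner z (S x) = qcnj (c z) * qinner z x" if "z \<in> N" for z x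
    unfolding S_def by (rule qinner_diagonal_operator[OF N _ that, of _ C]) (simp add: C)
  have "qinner (S u) v = qinner u (T v)" for u v
  proof (rule has_sum_unique)
    show "((\<lambda>z. qcnj (qinner z (S u)) * qinner z v) has_sum qinner (S u) v) N"
      by (rule has_sum_qinner[OF N])
    have "((\<lambda>z. qcnj (qinner z u) * qinner z (T v)) has_sum qinner u (T v)) N"
      by (rule has_sum_qinner[OF N])
    then show "((\<lambda>z. qcnj (qinner z (S u)) * qinner z v) has_sum qinner u (T v)) N"
      by (rule has_sum_cong[THEN iffD1, rotated]) (simp add: S T qcnj_mult mult.assoc)
  qed
  then have "qadjoint T = S"
    by (rule qadjoint_eqI)
  moreover have "T (S x) = S (T x)" for x
    by (rule hilbert_basis_eqI[OF N]) (simp add: S T qcnj_mult_commute flip: mult.assoc)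
  ultimately show ?thesis
    by (simp add: normal_operator_def fun_eq_iff)
qed

section \<open>Compactness\<close>

text \<open>Uniform approximation by compact sets makes the image of each ball totally bounded, so
  its closure in the complete space is compact.\<close>

lemma compact_operatorI:
  assumes "\<And>R e. 0 < e \<Longrightarrow> \<exists>K. compact K \<and> (\<forall>x. norm x \<le> R \<longrightarrow> (\<exists>y\<in>K. dist y (T x) < e))"
  shows "compact_operator T"
  unfolding compact_operator_def
proof (intro allI impI)
  fix X :: "nat \<Rightarrow> 'a"
  assume "bounded (range X)"
  then obtain R where R: "\<And>n. norm (X n) \<le> R"
    by (auto simp: bounded_iff)
  let ?S = "closure (T ` cball 0 R)"
  \<comment> \<open>One third of \<open>e\<close> is spent on leaving the closure, one on passing to
    \<open>K\<close>, and one on a finite net of \<open>K\<close>.\<close>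
  have "\<exists>k. finite k \<and> ?S \<subseteq> (\<Union>x\<in>k. ball x e)" if "0 < e" for e
  proof -
    from assms[of "e / 3" R] that obtain K where K: "compact K"
      "\<And>x. norm x \<le> R \<Longrightarrow> \<exists>y\<in>K. dist y (T x) < e / 3"
      by auto
    from K(1) that obtain k where k: "finite k" "K \<subseteq> (\<Union>x\<in>k. ball x (e / 3))"
      unfolding compact_eq_totally_bounded by (meson divide_pos_pos zero_less_numeral)
    have "y \<in> (\<Union>x\<in>k. ball x e)" if y: "y \<in> ?S" for y
    proof -
      obtain x where x: "norm x \<le> R" "dist (T x) y < e / 3"
        using y \<open>0 < e\<close> closure_approachable[of y "T ` cball 0 R"]
        by (metis divide_pos_pos imageE mem_cball_0 zero_less_numeral)
      obtain w where w: "w \<in> K" "dist w (T x) < e / 3"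
        using K(2) x(1) by blast
      then obtain v where v: "v \<in> k" "dist v w < e / 3"
        using k(2) by auto
      have "dist v y < e"
        using v(2) w(2) x(2) dist_triangle[of v y w] dist_triangle[of w y "T x"] by linarith
      with v(1) show ?thesis
        by auto
    qed
    with k(1) show ?thesis
      by blast
  qed
  then have "compact ?S"
    by (simp add: compact_eq_totally_bounded complete_eq_closed)
  moreover have "T (X n) \<in> ?S" for n
    using R closure_subset by fastforce
  ultimately obtain l r where "strict_mono (r :: nat \<Rightarrow> nat)" "((\<lambda>n. T (X n)) \<circ> r) \<longlonglongrightarrow> l"
    unfolding compact_def by metis
  then show "\<exists>r. strict_mono r \<and> convergent (\<lambda>n. T (X (r n)))"
    by (auto simp: convergent_def o_def)
qed

text \<open>By induction: each new basis direction adds, as a Minkowski sum, the continuous image of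
  a compact ball of quaternions.\<close>

lemma compact_finite_expansions:
  fixes F :: "'h::quat_hilbert set"
  assumes "finite F"
  shows "\<exists>K. compact K \<and> (\<forall>a. (\<forall>z\<in>F. norm (a z) \<le> C) \<longrightarrow> (\<Sum>z\<in>F. z *\<^sub>H a z) \<in> K)"
  using assms
proof (induction F rule: finite_induct)
  case empty
  show ?case
    by (rule exI[of _ "{0}"]) simp
next
  case (insert w F)
  then obtain K where K: "compact K" "\<And>a. (\<forall>z\<in>F. norm (a z) \<le> C) \<Longrightarrow> (\<Sum>z\<in>F. z *\<^sub>H a z) \<in> K"
    by blast
  let ?L = "(\<lambda>p. w *\<^sub>H p) ` cball 0 C"
  have "compact ?L"
    using bounded_linear_qscale
    by (intro compact_continuous_image compact_cball_quat linear_continuous_on)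
  with K(1) have "compact {x + y |x y. x \<in> ?L \<and> y \<in> K}"
    by (intro compact_sums)
  moreover have "(\<Sum>z\<in>insert w F. z *\<^sub>H a z) \<in> {x + y |x y. x \<in> ?L \<and> y \<in> K}"
    if "\<forall>z\<in>insert w F. norm (a z) \<le> C" for a
    using that K(2)[of a] insert.hyps by fastforce
  ultimately show ?case
    by blast
qed

text \<open>Truncation to the finitely many entries of norm at least \<open>d\<close> has finite
  rank and differs from \<open>T\<close> by at most \<open>d\<close> in operator norm.\<close>

lemma compact_operator_diagonal:
  assumes N: "hilbert_basis N"
    and fin: "\<And>e. 0 < e \<Longrightarrow> finite {z \<in> N. e \<le> norm (c z)}"
    and T: "\<And>z x. z \<in> N \<Longrightarrow> qinner z (T x) = c z * qinner z x"
  shows "compact_operator T"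
proof (rule compact_operatorI)
  fix R e :: real
  assume "0 < e"
  \<comment> \<open>Chosen so that \<open>d * \<bar>R\<bar> < e\<close>; the summand 1 keeps the
    denominator positive.\<close>
  define d where "d = e / (\<bar>R\<bar> + 1)"
  have d: "0 < d"
    using \<open>0 < e\<close> by (simp add: d_def add_nonneg_pos)
  define F where "F = {z \<in> N. d \<le> norm (c z)}"
  have F: "finite F" "F \<subseteq> N"
    using fin[OF d] by (auto simp: F_def)
  define P where "P x = (\<Sum>z\<in>F. z *\<^sub>H (c z * qinner z x))" for x
  \<comment> \<open>A crude bound for the entries over \<open>F\<close>, meaningful also when
    \<open>F\<close> is empty.\<close>
  define M where "M = (\<Sum>z\<in>F. norm (c z))"
  obtain K where K: "compact K" "\<And>a. (\<forall>z\<in>F. norm (a z) \<le> M * R) \<Longrightarrow> (\<Sum>z\<in>F. z *\<^sub>H a z) \<in> K"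
    using compact_finite_expansions[OF F(1)] by metis
  have "P x \<in> K \<and> dist (P x) (T x) < e" if x: "norm x \<le> R" for x
  proof
    show "P x \<in> K"
      unfolding P_def
    proof (intro K(2) ballI)
      fix z
      assume "z \<in> F"
      then have "norm (c z) \<le> M"
        unfolding M_def using F(1) by (intro member_le_sum) auto
      moreover have "norm (qinner z x) \<le> R"
        using norm_qinner_le[of z x] norm_hilbert_basis[OF N, of z] \<open>z \<in> F\<close> F(2) x by auto
      ultimately show "norm (c z * qinner z x) \<le> M * R"
        unfolding norm_mult by (intro mult_mono') auto
    qed
    \<comment> \<open>Coefficients in \<open>F\<close> cancel; the others are multiplied by entries
      of norm below \<open>d\<close>.\<close>
    have "norm (P x - T x) \<le> d * norm x"
    proof (rule norm_le_of_coefficients_le[OF N])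
      fix z
      assume z: "z \<in> N"
      then have "qinner z (P x - T x) = (if z \<in> F then 0 else - (c z * qinner z x))"
        by (simp add: P_def qinner_diff_right qinner_finite_expansion[OF N z F(2,1)] T)
      moreover have "norm (c z) \<le> d" if "z \<notin> F"
        using that z by (simp add: F_def)
      ultimately show "norm (qinner z (P x - T x)) \<le> d * norm (qinner z x)"
        using d by (auto simp: norm_mult intro: mult_right_mono)
    qed (use d in simp)
    also have "\<dots> \<le> d * \<bar>R\<bar>"
      using d x by (intro mult_left_mono) auto
    also have "\<dots> < e"
      using \<open>0 < e\<close> by (simp add: d_def field_simps)
    finally show "dist (P x) (T x) < e"
      by (simp add: dist_norm)
  qed
  with K(1) show "\<exists>K. compact K \<and> (\<forall>x. norm x \<le> R \<longrightarrow> (\<exists>y\<in>K. dist y (T x) < e))"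
    by blast
qed

section \<open>Inversion and the spherical spectrum\<close>

text \<open>The inverse entries are bounded by \<open>inverse m\<close>, so they define a diagonal
  operator, which inverts \<open>D\<close> on both sides.\<close>

lemma diagonal_bijection:
  assumes N: "hilbert_basis N" and m: "0 < m" "\<And>z. z \<in> N \<Longrightarrow> m \<le> norm (d z)"
    and D: "\<And>z x. z \<in> N \<Longrightarrow> qinner z (D x) = d z * qinner z x"
  shows "bij D" and "norm (inv D y) \<le> norm y / m"
proof -
  define E where "E = diagonal_operator N (\<lambda>z. inverse (d z))"
  have d: "d z \<noteq> 0" and le: "norm (inverse (d z)) \<le> inverse m" if "z \<in> N" for z
    using m that by (force, simp add: norm_inverse le_imp_inverse_le)
  have E: "qinner z (E x) = inverse (d z) * qinner z x" if "z \<in> N" for z x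
    unfolding E_def by (rule qinner_diagonal_operator[OF N le that])
  have DE: "D (E x) = x" and ED: "E (D x) = x" for x
    by (rule hilbert_basis_eqI[OF N], simp add: D E d flip: mult.assoc)+
  show "bij D"
    by (rule o_bij[of E]) (auto simp: DE ED)
  have "inv D y = E y"
    using \<open>bij D\<close> by (intro inv_f_eq) (auto simp: DE bij_def)
  moreover have "norm (E y) \<le> inverse m * norm y"
    using m(1) by (intro norm_le_of_coefficients_le[OF N]) (auto simp: E norm_mult intro!: mult_right_mono le)
  ultimately show "norm (inv D y) \<le> norm y / m"
    by (simp add: divide_inverse mult.commute)
qed

lemma qinner_Delta_op:
  assumes T: "\<And>x. qinner z (T x) = c * qinner z x"
  shows "qinner z (Delta_op q T x) =
    (c * c - c * (q + qcnj q) + of_real ((norm q)\<^sup>2)) * qinner z x"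
proof -
  \<comment> \<open>The scalars in \<Delta>_q are real, hence central, and pass from the right of
    \<open>qinner z x\<close> to its left.\<close>
  have "p * of_real r = of_real r * p" for p :: quat and r
    by (simp add: quat_eq_iff algebra_simps)
  then show ?thesis
    unfolding Delta_op_def add_qcnj qinner_add_right qinner_diff_right qinner_scale_right T
    by (metis (no_types, opaque_lifting) left_diff_distrib distrib_right mult.assoc)
qed

lemma spherical_spectrum_diagonal:
  assumes N: "hilbert_basis N"
    and fin: "\<And>e. 0 < e \<Longrightarrow> finite {z \<in> N. e \<le> norm (c z)}"
    and T: "\<And>z x. z \<in> N \<Longrightarrow> qinner z (T x) = c z * qinner z x"
  shows "spherical_spectrum T - {0} = circularization (c ` N) - {0}"
proof -
  define p where "p q z = c z * c z - c z * (q + qcnj q) + of_real ((norm q)\<^sup>2)" for q z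
  have Delta: "qinner z (Delta_op q T x) = p q z * qinner z x" if "z \<in> N" for z q x
    unfolding p_def by (rule qinner_Delta_op[OF T[OF that]])
  have p0: "p q z = 0 \<longleftrightarrow> qRe (c z) = qRe q \<and> norm (c z) = norm q" for q z
    unfolding p_def by (rule quat_polynomial_eq_0_iff)
  have "q \<in> spherical_spectrum T" if q: "q \<in> circularization (c ` N)" for q
  proof -
    obtain z where z: "z \<in> N" "p q z = 0"
      using q by (auto simp: circularization_iff p0)
    \<comment> \<open>The basis vector \<open>z\<close> has a single nonzero coefficient, and it
      meets a zero entry.\<close>
    have "Delta_op q T z = 0"
      by (rule hilbert_basis_eqI[OF N]) (use z in \<open>auto simp: Delta qinner_hilbert_basis[OF N]\<close>)
    moreover have "z \<noteq> 0"
      using norm_hilbert_basis[OF N z(1)] by auto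
    ultimately show ?thesis
      by (auto simp: spherical_spectrum_def spherical_resolvent_def)
  qed
  moreover have "q \<in> spherical_resolvent T" if q: "q \<notin> circularization (c ` N)" "q \<noteq> 0" for q
  proof -
    define F where "F = {z \<in> N. norm q / 8 \<le> norm (c z)}"
    \<comment> \<open>A uniform lower bound for the entries of \<Delta>_q: the inserted number
      handles the small \<open>c z\<close> outside \<open>F\<close>, the minimum the finitely many
      others.\<close>
    define m where "m = Min (insert ((norm q)\<^sup>2 / 2) ((\<lambda>z. norm (p q z)) ` F))"
    have F: "finite F"
      unfolding F_def using q(2) by (intro fin) simp
    have "p q z \<noteq> 0" if "z \<in> N" for z
      using q(1) that by (auto simp: circularization_iff p0)
    then have m: "0 < m"
      unfolding m_def using F q(2) by (auto simp: F_def)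
    have le: "m \<le> norm (p q z)" if "z \<in> N" for z
    proof (cases "z \<in> F")
      case True
      then show ?thesis
        unfolding m_def using F by (intro Min_le) auto
    next
      case False
      then have "norm (c z) \<le> norm q / 8"
        using that by (simp add: F_def)
      then have "(norm q)\<^sup>2 / 2 \<le> norm (p q z)"
        unfolding p_def by (rule norm_quat_polynomial_ge)
      moreover have "m \<le> (norm q)\<^sup>2 / 2"
        unfolding m_def using F by (intro Min_le) auto
      ultimately show ?thesis
        by linarith
    qed
    have bij: "bij (Delta_op q T)" and inv: "norm (inv (Delta_op q T) y) \<le> norm y / m" for y
      using diagonal_bijection[OF N m le Delta] by auto
    have "Delta_op q T 0 = 0"
      by (rule hilbert_basis_eqI[OF N]) (simp add: Delta)
    then have "{u. Delta_op q T u = 0} = {0}"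
      using inj_eq[OF bij_is_inj[OF bij], of _ 0] by simp
    moreover have "closure (range (Delta_op q T)) = UNIV"
      using bij by (simp add: bij_is_surj)
    moreover have "\<exists>K\<ge>0. \<forall>y\<in>range (Delta_op q T). norm (inv (Delta_op q T) y) \<le> K * norm y"
      using inv m by (intro exI[of _ "1 / m"]) auto
    ultimately show ?thesis
      by (simp add: spherical_resolvent_def)
  qed
  ultimately show ?thesis
    by (auto simp: spherical_spectrum_def)
qed

section \<open>Diagonal entries of the given operator\<close>

theorem theorem1p4:
  fixes T :: "'h::quat_hilbert \<Rightarrow> 'h"
    and N :: "'h set"
    and lam :: "'h \<Rightarrow> quat"
    and \<Lambda> :: "quat set"
  assumes "right_linear T"
    and "bounded_operator T"
    and "hilbert_basis N"
    and "\<Lambda> = lam ` N"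
    and "\<And>x. ((\<lambda>z. z *\<^sub>H lam z *\<^sub>H qinner z x) has_sum T x) N"
    and "\<And>z. z \<in> N \<Longrightarrow> lam z \<noteq> 0 \<Longrightarrow> finite {z' \<in> N. z' \<noteq> z \<and> lam z = lam z'}"
    and "countable \<Lambda>"
    and "\<And>\<epsilon>::real. \<epsilon> > 0 \<Longrightarrow> \<exists>\<Lambda>\<^sub>\<epsilon>. finite \<Lambda>\<^sub>\<epsilon> \<and> \<Lambda>\<^sub>\<epsilon> \<subseteq> \<Lambda> \<and> (\<forall>l \<in> \<Lambda> - \<Lambda>\<^sub>\<epsilon>. norm l < \<epsilon>)"
  shows "normal_operator T \<and> compact_operator T \<and>
         spherical_spectrum T - {0} = circularization \<Lambda> - {0}"
proof -
  have T: "qinner z (T x) = lam z * qinner z x" if "z \<in> N" for z x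
    using qinner_expansion[OF assms(3) that, of "\<lambda>z. lam z * qinner z x"] assms(5)[of x]
    by (simp add: qscale_qscale)
  have fin: "finite {z \<in> N. e \<le> norm (lam z)}" if e: "0 < e" for e :: real
  proof -
    obtain L where L: "finite L" "\<forall>l \<in> \<Lambda> - L. norm l < e"
      using assms(8)[OF e] by blast
    have "{z \<in> N. e \<le> norm (lam z)} \<subseteq> (\<Union>l\<in>L - {0}. {z \<in> N. lam z = l})"
      using L(2) e assms(4) by force
    moreover have "finite {z \<in> N. lam z = l}" if "l \<noteq> 0" for l
    proof (cases "\<exists>w\<in>N. lam w = l")
      case True
      then obtain w where w: "w \<in> N" "lam w = l"
        by blast
      \<comment> \<open>The hypothesis speaks of elements other than \<open>w\<close>, so
        \<open>w\<close> is put back.\<close>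
      have "{z \<in> N. lam z = l} \<subseteq> insert w {z \<in> N. z \<noteq> w \<and> lam w = lam z}"
        using w by auto
      then show ?thesis
        using assms(6)[OF w(1)] w(2) that by (auto intro: finite_subset)
    next
      case False
      then have "{z \<in> N. lam z = l} = {}"
        by blast
      then show ?thesis
        using finite.emptyI by metis
    qed
    ultimately show ?thesis
      using L(1) by (auto intro: finite_subset)
  qed
  obtain C where C: "\<And>u. norm (T u) \<le> C * norm u"
    using assms(2) unfolding bounded_operator_def by blast
  \<comment> \<open>The entry equals \<open>qinner z (T z)\<close> with \<open>z\<close> a unit
    vector, so Cauchy-Schwarz applies.\<close>
  have "norm (lam z) \<le> C" if "z \<in> N" for z
    using norm_qinner_le[of z "T z"] C[of z] T[OF that, of z]
    by (simp add: norm_hilbert_basis[OF assms(3) that] qinner_hilbert_basis[OF assms(3) that that])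
  then show ?thesis
    using normal_operator_diagonal[OF assms(3) _ T] compact_operator_diagonal[OF assms(3) fin T]
      spherical_spectrum_diagonal[OF assms(3) fin T] assms(4)
    by blast
qed

end
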